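(* Let $N\ge2$, $\epsilon>0$ and $T\ge1$. For every online learning algorithm for the prediction with expert advice problem with $N$ experts, there exists a sequence of loss vectors $\boldsymbol{l}_1,\dots,\boldsymbol{l}_T\in[-\sqrt{\epsilon},\sqrt{\epsilon}]^N$ with $\|\boldsymbol{l}_t\|_2^2\le\epsilon$ for all $t\in\{1,\dots,T\}$, such that $$\mathrm{Regret}_T\ge\sqrt{\frac{\epsilon T}{4}}.$$
   Context: Prediction with expert advice: in each round $t=1,\dots,T$ the learner plays $\mathbf{p}_t\in\Delta_N=\{\mathbf{x}\in[0,1]^N:\sum_ix_i=1\}$, then the loss vector $\boldsymbol{l}_t\in\mathbb{R}^N$ is revealed and the learner suffers $\mathbf{p}_t\cdot\boldsymbol{l}_t$. An online learning algorithm is a rule choosing each $\mathbf{p}_t$ as a function of $\boldsymbol{l}_1,\dots,\boldsymbol{l}_{t-1}$. The regret is $\mathrm{Regret}_T=\sum_{t=1}^T\mathbf{p}_t\cdot\boldsymbol{l}_t-\min_{i\in\{1,\dots,N\}}\sum_{t=1}^T l_t(i)$. *)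

theory Defs
  imports "HOL-Analysis.Analysis"
begin

definition prob_simplex :: "(real ^ 'n) set" where
  "prob_simplex = {x. (\<forall>i. x $ i \<in> {0..1}) \<and> (\<Sum>i\<in>UNIV. x $ i) = 1}"

text \<open>
  An algorithm maps the list of the loss vectors revealed so far, oldest first, to the next play.
  In a game of T rounds only histories shorter than T occur.
\<close>

definition online_algorithm :: "nat \<Rightarrow> ((real ^ 'n) list \<Rightarrow> real ^ 'n) \<Rightarrow> bool" where
  "online_algorithm T A \<longleftrightarrow> (\<forall>h. length h < T \<longrightarrow> A h \<in> prob_simplex)"

definition play :: "((real ^ 'n) list \<Rightarrow> real ^ 'n) \<Rightarrow> (nat \<Rightarrow> real ^ 'n) \<Rightarrow> nat \<Rightarrow> real ^ 'n" where
  "play A l t = A (map l [1..<t])"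

definition regret :: "((real ^ 'n) list \<Rightarrow> real ^ 'n) \<Rightarrow> (nat \<Rightarrow> real ^ 'n) \<Rightarrow> nat \<Rightarrow> real" where
  "regret A l T =
     (\<Sum>t=1..T. play A l t \<bullet> l t) - Min (range (\<lambda>i. \<Sum>t=1..T. l t $ i))"

end

theory Submission
  imports Defs
begin

text \<open>
  The adversary charges only two experts \<open>i \<noteq> j\<close>, with losses \<open>\<plusminus>sqrt (\<epsilon> / 2)\<close> of opposite signs.
  Choosing the sign in each round by the potential \<open>x \<mapsto> E \<bar>x + S\<^sub>n\<bar>\<close>, where \<open>S\<^sub>n\<close> is a simple random
  walk over the \<open>n\<close> remaining rounds, derandomizes the bound that random signs give in expectation,
  so the regret is at least \<open>sqrt (\<epsilon> / 2) * E \<bar>S\<^sub>T\<bar>\<close>. Since \<open>E \<bar>S\<^sub>T\<bar>\<close> is the expected number of visits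
  to the origin before time \<open>T\<close>, it is the sum of \<open>(2j choose j) / 4^j\<close> over \<open>2j < T\<close>, which is at
  least \<open>sqrt (T / 2)\<close>.
\<close>

primrec walk_abs :: "nat \<Rightarrow> int \<Rightarrow> real" where
  "walk_abs 0 x = \<bar>of_int x\<bar>"
| "walk_abs (Suc n) x = (walk_abs n (x + 1) + walk_abs n (x - 1)) / 2"

text \<open>The probability that a simple random walk started at \<open>x\<close> is at the origin
  after \<open>n\<close> steps, by conditioning on the first step.\<close>

primrec walk_hit :: "nat \<Rightarrow> int \<Rightarrow> real" where
  "walk_hit 0 x = (if x = 0 then 1 else 0)"
| "walk_hit (Suc n) x = (walk_hit n (x + 1) + walk_hit n (x - 1)) / 2"

lemma walk_hit_nonneg: "walk_hit n x \<ge> 0"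
  by (induction n arbitrary: x) auto

lemma walk_hit_far: "x > int n \<Longrightarrow> walk_hit n x = 0"
  by (induction n arbitrary: x) auto

text \<open>From \<open>n - 2k\<close>, the walk ends at the origin iff exactly \<open>k\<close> of
  its \<open>n\<close> steps go up. Conditioning on the first step gives Pascal's rule; for
  \<open>k = 0\<close> an upward step leaves the origin out of reach.\<close>

lemma walk_hit_binomial: "walk_hit n (int n - 2 * int k) = real (n choose k) / 2 ^ n"
proof (induction n arbitrary: k)
  case 0
  then show ?case by (cases k) auto
next
  case (Suc n)
  show ?case
  proof (cases k)
    case 0
    then show ?thesis
      using Suc.IH[of 0] walk_hit_far[of n "int n + 2"] by (simp add: algebra_simps)
  next
    case (Suc m)
    have "walk_hit (Suc n) (int (Suc n) - 2 * int k)
        = (walk_hit n (int n - 2 * int m) + walk_hit n (int n - 2 * int (Suc m))) / 2"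
      using Suc by (simp add: algebra_simps)
    also have "\<dots> = (real (n choose m) / 2 ^ n + real (n choose Suc m) / 2 ^ n) / 2"
      by (simp only: Suc.IH)
    finally show ?thesis
      using Suc by (simp add: add_divide_distrib)
  qed
qed

lemma walk_hit_even_zero: "walk_hit (2 * j) 0 = real ((2 * j) choose j) / 4 ^ j"
  using walk_hit_binomial[of "2 * j" j] by (simp add: power_mult)

text \<open>A step from y preserves the mean of the absolute value unless y = 0, where it raises it
  from 0 to 1. So each visit to the origin before time \<open>n\<close> contributes 1.\<close>

lemma walk_abs_eq_sum_hit: "walk_abs n x = \<bar>of_int x\<bar> + (\<Sum>j<n. walk_hit j x)"
proof (induction n arbitrary: x)
  case (Suc n)
  have "(\<Sum>j<Suc n. walk_hit j x)
      = walk_hit 0 x + ((\<Sum>j<n. walk_hit j (x + 1)) + (\<Sum>j<n. walk_hit j (x - 1))) / 2"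
    by (simp only: sum.lessThan_Suc_shift walk_hit.simps(2) sum_divide_distrib[symmetric] sum.distrib)
  moreover have "(\<bar>of_int (x + 1)\<bar> + \<bar>of_int (x - 1)\<bar>) / 2 = \<bar>of_int x :: real\<bar> + walk_hit 0 x"
  proof -
    have "\<bar>x + 1\<bar> + \<bar>x - 1\<bar> = 2 * \<bar>x\<bar> + (if x = 0 then 2 else 0)"
      by auto
    then have "real_of_int (\<bar>x + 1\<bar> + \<bar>x - 1\<bar>) = real_of_int (2 * \<bar>x\<bar> + (if x = 0 then 2 else 0))"
      by (simp only:)
    then show ?thesis by (simp split: if_splits)
  qed
  ultimately show ?case
    by (simp add: Suc.IH add_divide_distrib)
qed simp

lemma Suc_times_central_binomial_Suc:
  "Suc j * ((2 * Suc j) choose Suc j) = 2 * (2 * j + 1) * ((2 * j) choose j)"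
proof -
  have "Suc j * (Suc (Suc (2 * j)) choose Suc j) = Suc (Suc (2 * j)) * (Suc (2 * j) choose j)"
    by (rule Suc_times_binomial)
  also have "Suc (2 * j) choose j = Suc (2 * j) choose Suc j"
    by (subst binomial_symmetric) auto
  also have "Suc (Suc (2 * j)) * (Suc (2 * j) choose Suc j)
      = 2 * (Suc j * (Suc (2 * j) choose Suc j))"
    by (simp del: binomial_Suc_Suc)
  also have "Suc j * (Suc (2 * j) choose Suc j) = Suc (2 * j) * ((2 * j) choose j)"
    by (rule Suc_times_binomial)
  finally show ?thesis by (simp del: binomial_Suc_Suc)
qed

lemma walk_hit_even_zero_Suc:
  "walk_hit (2 * Suc j) 0 = walk_hit (2 * j) 0 * ((2 * real j + 1) / (2 * real j + 2))"
proof -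
  have "real (Suc j * ((2 * Suc j) choose Suc j)) = real (2 * (2 * j + 1) * ((2 * j) choose j))"
    by (simp only: Suc_times_central_binomial_Suc)
  then have "(real j + 1) * real ((2 * Suc j) choose Suc j)
      = 2 * (2 * real j + 1) * real ((2 * j) choose j)"
    by (simp add: algebra_simps del: binomial_Suc_Suc)
  then have "real ((2 * Suc j) choose Suc j)
      = 2 * (2 * real j + 1) * real ((2 * j) choose j) / (real j + 1)"
    by (simp add: eq_divide_eq mult.commute del: binomial_Suc_Suc)
  then show ?thesis
    unfolding walk_hit_even_zero
    by (simp add: divide_simps del: binomial_Suc_Suc mult_Suc_right) (simp add: algebra_simps)
qed

text \<open>With r = \<open>Suc j\<close> and w the return probability at time 2r, the quantity 4 r
  w^2 equals 1 at r = 1. Passing to r + 1 multiplies it by (2r+1)^2 / (4r(r+1)), which is at least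
  1.\<close>

lemma walk_hit_even_zero_lower: "4 * real (Suc j) * (walk_hit (2 * Suc j) 0)\<^sup>2 \<ge> 1"
proof (induction j)
  case 0
  show ?case by (simp add: walk_hit_even_zero_Suc[of 0, simplified] numeral_2_eq_2)
next
  case (Suc j)
  define r w where "r = real (Suc j)" and "w = walk_hit (2 * Suc j) 0"
  have r: "r > 0" by (simp add: r_def)
  have "1 \<le> 4 * r * w\<^sup>2" using Suc.IH by (simp only: r_def w_def)
  also have "4 * r * w\<^sup>2 * 1 \<le> 4 * r * w\<^sup>2 * ((2 * r + 1)\<^sup>2 / (4 * r * (r + 1)))"
    using r by (intro mult_left_mono) (auto simp: le_divide_eq_1 power2_eq_square algebra_simps add_pos_pos)
  also have "\<dots> = 4 * (r + 1) * (w * ((2 * r + 1) / (2 * r + 2)))\<^sup>2"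
  proof -
    have "(2 * r + 2)\<^sup>2 = 4 * (r + 1)\<^sup>2" by (simp add: power2_eq_square algebra_simps)
    then show ?thesis
      using r by (simp add: power_mult_distrib power_divide) (simp add: divide_simps power2_eq_square)
  qed
  also have "\<dots> = 4 * real (Suc (Suc j)) * (walk_hit (2 * Suc (Suc j)) 0)\<^sup>2"
    unfolding walk_hit_even_zero_Suc[of "Suc j"] r_def w_def
    by (simp del: walk_hit.simps mult_Suc_right add: add.commute)
  finally show ?case by simp
qed

text \<open>For j > 0 both sides are compared with 1 / (2 sqrt j). The increment form makes the sum
  over return times telescope.\<close>

lemma sqrt_Suc_diff_le_walk_hit: "sqrt (real (Suc j)) - sqrt (real j) \<le> walk_hit (2 * j) 0"
proof (cases j)
  case (Suc m)
  define s where "s = sqrt (real j)"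
  have s: "s > 0" "s\<^sup>2 = real j" using Suc by (auto simp: s_def)
  have "1\<^sup>2 \<le> (2 * s * walk_hit (2 * j) 0)\<^sup>2"
    using walk_hit_even_zero_lower[of m] unfolding Suc[symmetric] power_mult_distrib s(2) by simp
  then have hit: "1 \<le> 2 * s * walk_hit (2 * j) 0"
    by (rule power2_le_imp_le) (use s walk_hit_nonneg in simp)
  have "sqrt (real (Suc j)) \<le> s + 1 / (2 * s)"
  proof (rule real_le_lsqrt)
    have "(s + 1 / (2 * s))\<^sup>2 = s\<^sup>2 + 1 + (1 / (2 * s))\<^sup>2"
      using s by (simp add: power2_sum)
    then show "real (Suc j) \<le> (s + 1 / (2 * s))\<^sup>2" using s by simp
  qed (use s in auto)
  also have "1 / (2 * s) \<le> walk_hit (2 * j) 0"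
    using hit s by (simp add: field_simps)
  finally show ?thesis by (simp add: s_def)
qed simp

lemma walk_abs_zero_lower: "walk_abs n 0 \<ge> sqrt (real n / 2)"
proof -
  \<comment> \<open>The number of even times below \<open>n\<close>, which is at least n/2; visits
    at odd times are dropped.\<close>
  define m where "m = (n + 1) div 2"
  have "sqrt (real n / 2) \<le> sqrt (real m)"
    unfolding m_def by (intro real_sqrt_le_mono) linarith
  also have "\<dots> = (\<Sum>j<m. sqrt (real (Suc j)) - sqrt (real j))"
    using sum_lessThan_telescope[of "\<lambda>j. sqrt (real j)" m] by simp
  also have "\<dots> \<le> (\<Sum>j<m. walk_hit (2 * j) 0)"
    by (intro sum_mono sqrt_Suc_diff_le_walk_hit)
  also have "\<dots> = (\<Sum>k\<in>(\<lambda>j. 2 * j) ` {..<m}. walk_hit k 0)"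
    by (subst sum.reindex) (auto simp: inj_on_def)
  also have "\<dots> \<le> (\<Sum>k<n. walk_hit k 0)"
    by (intro sum_mono2) (auto simp: m_def walk_hit_nonneg)
  also have "\<dots> = walk_abs n 0"
    by (simp add: walk_abs_eq_sum_hit)
  finally show ?thesis .
qed

text \<open>Here \<open>g\<close> stands for the learner's reaction to the signs so far, and
  \<open>x\<close> for the sum of the signs already played. Both must vary in the induction, as
  fixing the first sign shifts \<open>x\<close> and prefixes the history.\<close>

lemma ex_adversarial_signs:
  fixes g :: "int list \<Rightarrow> real"
  shows "\<exists>es. length es = n \<and> set es \<subseteq> {1, -1} \<and>
    walk_abs n x \<le> (\<Sum>t<n. of_int (es ! t) * g (take t es)) + \<bar>of_int (x + sum_list es)\<bar>"
proof (induction n arbitrary: x g)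
  case (Suc n)
  \<comment> \<open>Averaged over both signs, the \<open>g []\<close> term cancels and the right
    side equals the left, so one sign does at least as well.\<close>
  have "\<exists>e\<in>{1, -1}. walk_abs (Suc n) x \<le> of_int e * g [] + walk_abs n (x + e)"
    by auto
  then obtain e where e: "e \<in> {1, -1}"
    "walk_abs (Suc n) x \<le> of_int e * g [] + walk_abs n (x + e)"
    by blast
  obtain es where es: "length es = n" "set es \<subseteq> {1, -1}"
    "walk_abs n (x + e) \<le> (\<Sum>t<n. of_int (es ! t) * g (e # take t es))
      + \<bar>of_int (x + e + sum_list es)\<bar>"
    using Suc.IH[of "x + e" "\<lambda>h. g (e # h)"] by blast
  have "walk_abs (Suc n) x \<le> (\<Sum>t<Suc n. of_int ((e # es) ! t) * g (take t (e # es)))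
      + \<bar>of_int (x + sum_list (e # es))\<bar>"
    using e(2) es(3) by (simp add: sum.lessThan_Suc_shift add.assoc del: walk_abs.simps sum.lessThan_Suc)
  then show ?case
    using e(1) es(1,2) by (intro exI[of _ "e # es"]) auto
qed simp

theorem corollary17:
  fixes \<epsilon> :: real and T :: nat
    and A :: "(real ^ 'n) list \<Rightarrow> real ^ 'n"
  assumes "CARD('n) \<ge> 2" and "\<epsilon> > 0" and "T \<ge> 1"
    and "online_algorithm T A"
  shows "\<exists>l :: nat \<Rightarrow> real ^ 'n.
           (\<forall>t\<in>{1..T}. (\<forall>i. l t $ i \<in> {- sqrt \<epsilon>..sqrt \<epsilon>}) \<and> (norm (l t))\<^sup>2 \<le> \<epsilon>) \<and>
           regret A l T \<ge> sqrt (\<epsilon> * real T / 4)"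
proof -
  obtain i j :: 'n where ij: "i \<noteq> j"
    using assms(1) card_2_iff' by (metis UNIV_I card_le_Suc0_iff_eq finite not_less_eq_eq numeral_2_eq_2)
  \<comment> \<open>Two entries of size \<open>a\<close> give squared norm 2 a^2 =
    \<epsilon>.\<close>
  define a where "a = sqrt (\<epsilon> / 2)"
  have a: "a > 0" "a\<^sup>2 = \<epsilon> / 2" using assms(2) by (auto simp: a_def)
  define v :: "real ^ 'n" where "v = a *\<^sub>R (axis i 1 - axis j 1)"
  have v: "v $ i = a" "v $ j = - a" using ij by (auto simp: v_def axis_def)
  have norm_v: "(norm v)\<^sup>2 = \<epsilon>"
    using ij a by (simp add: v_def power_mult_distrib power2_norm_eq_inner inner_diff_left
        inner_diff_right inner_axis_axis)
  define g where "g h = A (map (\<lambda>e. of_int e *\<^sub>R v) h) \<bullet> v / a" for h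
  obtain es where es: "length es = T" "set es \<subseteq> {1, -1}"
    "walk_abs T 0 \<le> (\<Sum>t<T. of_int (es ! t) * g (take t es)) + \<bar>of_int (sum_list es)\<bar>"
    using ex_adversarial_signs[of T 0 g] by auto
  define l where "l t = of_int (es ! (t - 1)) *\<^sub>R v" for t
  have norm_l: "(norm (l t))\<^sup>2 = \<epsilon>" if "t \<in> {1..T}" for t
  proof -
    have "es ! (t - 1) \<in> set es" using es(1) that by (intro nth_mem) auto
    then have "es ! (t - 1) \<in> {1, -1}" using es(2) by blast
    then have "norm (l t) = norm v" by (auto simp: l_def)
    then show ?thesis by (simp add: norm_v)
  qed
  have bounded: "l t $ k \<in> {- sqrt \<epsilon>..sqrt \<epsilon>}" if "t \<in> {1..T}" for t k
    using component_le_norm_cart[of "l t" k] real_sqrt_unique[OF norm_l[OF that]] by auto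
  \<comment> \<open>Rounds count from 1 and list positions from 0: the play in round
    \<open>Suc t\<close> depends on exactly the first \<open>t\<close> signs, as
    \<open>g (take t es)\<close> does.\<close>
  have history: "map l [1..<Suc t] = map (\<lambda>e. of_int e *\<^sub>R v) (take t es)" if "t < T" for t
    using that es(1) by (intro nth_equalityI) (auto simp: l_def simp del: upt_Suc)
  have learner: "(\<Sum>t=1..T. play A l t \<bullet> l t) = a * (\<Sum>t<T. of_int (es ! t) * g (take t es))"
    unfolding One_nat_def sum.atLeast1_atMost_eq sum_distrib_left
  proof (rule sum.cong)
    fix t assume "t \<in> {..<T}"
    then have "play A l (Suc t) \<bullet> l (Suc t)
        = of_int (es ! t) * (A (map (\<lambda>e. of_int e *\<^sub>R v) (take t es)) \<bullet> v)"
      unfolding play_def by (subst history) (auto simp: l_def)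
    then show "play A l (Suc t) \<bullet> l (Suc t) = a * (of_int (es ! t) * g (take t es))"
      using a(1) by (simp add: g_def)
  qed simp
  have expert: "(\<Sum>t=1..T. l t $ k) = of_int (sum_list es) * v $ k" for k
    unfolding One_nat_def sum.atLeast1_atMost_eq
    by (simp add: l_def sum_list_sum_nth es(1) atLeast0LessThan sum_distrib_right)
  have "Min (range (\<lambda>k. \<Sum>t=1..T. l t $ k)) \<le> (\<Sum>t=1..T. l t $ k)" for k
    by (rule Min_le) auto
  \<comment> \<open>The total losses of the two charged experts are opposite, so the smaller one is
    minus their common absolute value.\<close>
  from this[of i] this[of j]
  have "Min (range (\<lambda>k. \<Sum>t=1..T. l t $ k)) \<le> - (a * \<bar>of_int (sum_list es)\<bar>)"
    unfolding expert v by (auto simp: abs_if mult.commute)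
  then have "a * ((\<Sum>t<T. of_int (es ! t) * g (take t es)) + \<bar>of_int (sum_list es)\<bar>) \<le> regret A l T"
    unfolding regret_def learner distrib_left by linarith
  moreover have "a * sqrt (real T / 2) \<le> a * ((\<Sum>t<T. of_int (es ! t) * g (take t es)) + \<bar>of_int (sum_list es)\<bar>)"
    using walk_abs_zero_lower[of T] es(3) a(1) by (intro mult_left_mono) auto
  moreover have "a * sqrt (real T / 2) = sqrt (\<epsilon> * real T / 4)"
    by (simp add: a_def real_sqrt_mult[symmetric])
  ultimately have "sqrt (\<epsilon> * real T / 4) \<le> regret A l T" by simp
  then show ?thesis
    using norm_l bounded by (intro exI[of _ l]) auto
qed

end
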